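(* Assume $\mathrm{Det}(\mathbf{\Pi}^1_1)$. Then every perfect co-$K$-analytic Menger space is $\sigma$-compact.
   Context: Spaces are completely regular. $\mathrm{Det}(\mathbf{\Pi}^1_1)$: every length-$\omega$ perfect-information game on $\omega$ with co-analytic payoff set is determined. A space is perfect if every closed subset is a $G_\delta$. A space is $K$-analytic if it is a continuous image of a Lindelöf Čech-complete space; a space $X$ is co-$K$-analytic if its Stone–Čech remainder $\beta X\setminus X$ is $K$-analytic. Menger: for every sequence $(\mathcal{U}_n)$ of open covers there are finite $\mathcal{V}_n\subseteq\mathcal{U}_n$ with $\bigcup_n\mathcal{V}_n$ a cover. *)

theory Defs
  imports "HOL-Analysis.Analysis"
begin

text \<open>Boldface \<open>\<Sigma>\<^sup>1\<^sub>1\<close> sets: projections of closed subsets of \<open>\<omega>\<^sup>\<omega> \<times> \<omega>\<^sup>\<omega>\<close>.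
  The type \<^typ>\<open>nat \<Rightarrow> nat\<close> carries the product of the discrete topologies.\<close>

definition analytic_set :: "(nat \<Rightarrow> nat) set \<Rightarrow> bool" where
  "analytic_set A \<longleftrightarrow>
     (\<exists>C :: ((nat \<Rightarrow> nat) \<times> (nat \<Rightarrow> nat)) set. closed C \<and> A = fst ` C)"

definition coanalytic_set :: "(nat \<Rightarrow> nat) set \<Rightarrow> bool" where
  "coanalytic_set A \<longleftrightarrow> analytic_set (- A)"

text \<open>A run is a sequence \<open>x\<close>; player I chooses \<open>x 0, x 2, \<dots>\<close>, player II chooses
  \<open>x 1, x 3, \<dots>\<close>, and I wins the run iff \<open>x \<in> A\<close>. A strategy maps the finite list of all
  previous moves to the next move.\<close>

definition winning_strategy_I :: "(nat \<Rightarrow> nat) set \<Rightarrow> (nat list \<Rightarrow> nat) \<Rightarrow> bool" where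
  "winning_strategy_I A \<sigma> \<longleftrightarrow>
     (\<forall>x. (\<forall>n. x (2 * n) = \<sigma> (map x [0..<2 * n])) \<longrightarrow> x \<in> A)"

definition winning_strategy_II :: "(nat \<Rightarrow> nat) set \<Rightarrow> (nat list \<Rightarrow> nat) \<Rightarrow> bool" where
  "winning_strategy_II A \<tau> \<longleftrightarrow>
     (\<forall>x. (\<forall>n. x (2 * n + 1) = \<tau> (map x [0..<2 * n + 1])) \<longrightarrow> x \<notin> A)"

definition determined :: "(nat \<Rightarrow> nat) set \<Rightarrow> bool" where
  "determined A \<longleftrightarrow>
     (\<exists>\<sigma>. winning_strategy_I A \<sigma>) \<or> (\<exists>\<tau>. winning_strategy_II A \<tau>)"

definition coanalytic_determinacy :: bool where
  "coanalytic_determinacy \<longleftrightarrow> (\<forall>A. coanalytic_set A \<longrightarrow> determined A)"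

definition tychonoff_space :: "'a topology \<Rightarrow> bool" where
  "tychonoff_space X \<longleftrightarrow> completely_regular_space X \<and> Hausdorff_space X"

text \<open>Not to be confused with the type class \<^class>\<open>perfect_space\<close> (no isolated points).\<close>

definition closed_gdelta_space :: "'a topology \<Rightarrow> bool" where
  "closed_gdelta_space X \<longleftrightarrow> (\<forall>C. closedin X C \<longrightarrow> gdelta_in X C)"

definition Menger_space :: "'a topology \<Rightarrow> bool" where
  "Menger_space X \<longleftrightarrow>
     (\<forall>\<U> :: nat \<Rightarrow> 'a set set.
        (\<forall>n. (\<forall>U \<in> \<U> n. openin X U) \<and> \<Union> (\<U> n) = topspace X) \<longrightarrow>
        (\<exists>\<V> :: nat \<Rightarrow> 'a set set.
           (\<forall>n. finite (\<V> n) \<and> \<V> n \<subseteq> \<U> n) \<and> \<Union> (\<Union>n. \<V> n) = topspace X))"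

definition sigma_compact_space :: "'a topology \<Rightarrow> bool" where
  "sigma_compact_space X \<longleftrightarrow>
     (\<exists>K :: nat \<Rightarrow> 'a set. (\<forall>n. compactin X (K n)) \<and> (\<Union>n. K n) = topspace X)"

text \<open>For Tychonoff \<open>X\<close>, \<open>\<beta>X\<close> is the closure of the image of \<open>X\<close> under the evaluation map into
  the cube \<open>[0,1]\<close> to the power \<open>C(X,[0,1])\<close>. Functions on \<open>X\<close> are represented by functions that are
  extensional on \<^term>\<open>topspace X\<close>.\<close>

definition unit_functions :: "'a topology \<Rightarrow> ('a \<Rightarrow> real) set" where
  "unit_functions X =
     {f \<in> extensional (topspace X). continuous_map X (top_of_set {0..1}) f}"

definition unit_cube :: "'a topology \<Rightarrow> (('a \<Rightarrow> real) \<Rightarrow> real) topology" where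
  "unit_cube X = product_topology (\<lambda>f. top_of_set {0..1}) (unit_functions X)"

definition stone_cech_map :: "'a topology \<Rightarrow> 'a \<Rightarrow> ('a \<Rightarrow> real) \<Rightarrow> real" where
  "stone_cech_map X x = (\<lambda>f \<in> unit_functions X. f x)"

definition stone_cech :: "'a topology \<Rightarrow> (('a \<Rightarrow> real) \<Rightarrow> real) topology" where
  "stone_cech X =
     subtopology (unit_cube X) (unit_cube X closure_of (stone_cech_map X ` topspace X))"

definition stone_cech_remainder :: "'a topology \<Rightarrow> (('a \<Rightarrow> real) \<Rightarrow> real) topology" where
  "stone_cech_remainder X =
     subtopology (stone_cech X) (topspace (stone_cech X) - stone_cech_map X ` topspace X)"

lemma unit_functions_eq_mspace:
  "unit_functions X =
     mspace (submetric (cfunspace X euclidean_metric) {f. f \<in> topspace X \<rightarrow> {0..1}})"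
proof -
  have "bounded (f ` topspace X)" if "f \<in> topspace X \<rightarrow> {0..1}" for f :: "'a \<Rightarrow> real"
    by (rule bounded_subset [of "{0..1}"]) (use that in auto)
  then show ?thesis
    by (auto simp: unit_functions_def continuous_map_in_subtopology mbounded_iff_bounded
        Pi_iff image_subset_iff)
qed

lemma embedding_map_stone_cech_map_cube:
  assumes "tychonoff_space X"
  shows "embedding_map X (unit_cube X) (stone_cech_map X)"
  using completely_regular_space_cube_embedding_explicit [of X] assms
  unfolding tychonoff_space_def unit_cube_def stone_cech_map_def unit_functions_eq_mspace
  by simp

lemma stone_cech_map_subset_closure:
  "stone_cech_map X ` topspace X \<subseteq> unit_cube X closure_of (stone_cech_map X ` topspace X)"
proof (rule closure_of_subset)
  show "stone_cech_map X ` topspace X \<subseteq> topspace (unit_cube X)"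
  proof -
    have "f x \<in> {0..1}" if "f \<in> unit_functions X" "x \<in> topspace X" for f x
      using that unfolding unit_functions_def continuous_map_in_subtopology by auto
    then show ?thesis
      by (auto simp: unit_cube_def stone_cech_map_def)
  qed
qed

lemma embedding_map_stone_cech_map:
  assumes "tychonoff_space X"
  shows "embedding_map X (stone_cech X) (stone_cech_map X)"
  unfolding stone_cech_def
  using embedding_map_stone_cech_map_cube [OF assms] stone_cech_map_subset_closure
  by (simp add: embedding_map_in_subtopology)

lemma Hausdorff_stone_cech: "Hausdorff_space (stone_cech X)"
  unfolding stone_cech_def unit_cube_def
  by (intro Hausdorff_space_subtopology)
     (auto simp: Hausdorff_space_product_topology intro: Hausdorff_space_subtopology)

lemma compact_stone_cech: "compact_space (stone_cech X)"
proof -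
  have "compact_space (unit_cube X)"
    unfolding unit_cube_def
    by (auto simp: compact_space_product_topology compact_space_subtopology)
  then show ?thesis
    unfolding stone_cech_def
    by (simp add: closedin_compact_space compact_space_subtopology)
qed

lemma dense_stone_cech:
  "stone_cech X closure_of (stone_cech_map X ` topspace X) = topspace (stone_cech X)"
  using stone_cech_map_subset_closure [of X] closure_of_subset_topspace [of "unit_cube X"]
  unfolding stone_cech_def
  by (auto simp: closure_of_subtopology Int_absorb1)

lemma stone_cech_extension:
  assumes f: "continuous_map X (top_of_set {0..1::real}) f"
  obtains g where "continuous_map (stone_cech X) (top_of_set {0..1}) g"
    and "\<And>x. x \<in> topspace X \<Longrightarrow> g (stone_cech_map X x) = f x"
proof
  let ?f = "restrict f (topspace X)"
  have mem: "?f \<in> unit_functions X"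
    using f by (auto simp: unit_functions_def continuous_map_in_subtopology Pi_iff)
  then show "continuous_map (stone_cech X) (top_of_set {0..1}) (\<lambda>p. p ?f)"
    unfolding stone_cech_def unit_cube_def
    by (intro continuous_map_from_subtopology continuous_map_product_projection)
  show "stone_cech_map X x ?f = f x" if "x \<in> topspace X" for x
    using mem that by (simp add: stone_cech_map_def)
qed

definition Cech_complete_space :: "'a topology \<Rightarrow> bool" where
  "Cech_complete_space X \<longleftrightarrow>
     tychonoff_space X \<and> gdelta_in (stone_cech X) (stone_cech_map X ` topspace X)"

text \<open>HOL cannot quantify over types inside a formula, so the type \<open>'z\<close> of the points of the
  Lindelof Cech-complete preimage is an explicit parameter. A theorem that
  assumes K-analyticity for a free \<open>'z\<close> covers preimages of every type.\<close>

definition K_analytic_space :: "'z itself \<Rightarrow> 'a topology \<Rightarrow> bool" where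
  "K_analytic_space _ X \<longleftrightarrow>
     tychonoff_space X \<and>
     (\<exists>(Z :: 'z topology) f. Lindelof_space Z \<and> Cech_complete_space Z \<and>
        continuous_map Z X f \<and> f ` topspace Z = topspace X)"

definition co_K_analytic_space :: "'z itself \<Rightarrow> 'a topology \<Rightarrow> bool" where
  "co_K_analytic_space T X \<longleftrightarrow>
     tychonoff_space X \<and> K_analytic_space T (stone_cech_remainder X)"

end

theory Submission
  imports Defs
begin

text \<open>
  Let \<open>Y = \<beta>X\<close> and \<open>R = Y - X\<close>. Since \<open>R\<close> is K-analytic, \<open>R = (\<Union>\<alpha>. \<Inter>n. F (\<alpha>|n))\<close> for a decreasing
  scheme of closed sets \<open>F s\<close>. A perfect Menger space is hereditarily Lindelof, so countably many
  pairs of closed sets \<open>D i False \<union> D i True = Y\<close> separate \<open>X\<close> from every \<open>F s\<close> it misses. A point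
  \<open>b\<close> of the Cantor space codes the compact set \<open>Z b = (\<Inter>i. D i (b i))\<close>, which meets at most one of
  \<open>X\<close> and \<open>R\<close>, and \<open>B = {b. Z b \<inter> R \<noteq> {}}\<close> is analytic.

  Consider the game in which player I produces \<open>b\<close> together with a witness for \<open>b \<in> B\<close>, while player II
  may at any time force I to start a fresh witness. Player I wins if II interferes finitely often and
  the last witness is correct, or if II interferes infinitely often and \<open>b \<notin> B\<close>. The payoff is
  coanalytic. A winning strategy for II writes \<open>- B\<close> as a countable union of closed sets, whence \<open>X\<close> is
  \<open>\<sigma>\<close>-compact. A winning strategy for I maps the Cantor space continuously so that exactly the
  sequences with finitely many ones land in \<open>B\<close>; counting how late the \<open>k\<close>-th one appears then gives
  open covers of \<open>X\<close> that violate the Menger property.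
\<close>

section \<open>The game\<close>

lemma open_cylinder:
  fixes f :: "nat \<Rightarrow> 'b::discrete_topology"
  shows "open {g. \<forall>i<n. g i = f i}"
proof -
  have "open ((\<lambda>g. g i) -` {f i} :: (nat \<Rightarrow> 'b) set)" for i
    by (intro open_vimage open_discrete continuous_on_product_coordinates)
  then have "open (\<Inter>i\<in>{..<n}. (\<lambda>g. g i) -` {f i} :: (nat \<Rightarrow> 'b) set)"
    by (intro open_INT) auto
  moreover have "(\<Inter>i\<in>{..<n}. (\<lambda>g. g i) -` {f i}) = {g. \<forall>i<n. g i = f i}"
    by auto
  ultimately show ?thesis by simp
qed

lemma open_if_cylinders:
  fixes S :: "(nat \<Rightarrow> 'b::discrete_topology) set"
  assumes "\<And>f. f \<in> S \<Longrightarrow> \<exists>n. \<forall>g. (\<forall>i<n. g i = f i) \<longrightarrow> g \<in> S"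
  shows "open S"
proof (subst open_subopen, intro ballI)
  fix f assume "f \<in> S"
  then obtain n where "\<forall>g. (\<forall>i<n. g i = f i) \<longrightarrow> g \<in> S"
    using assms by blast
  then show "\<exists>T. open T \<and> f \<in> T \<and> T \<subseteq> S"
    by (intro exI[of _ "{g. \<forall>i<n. g i = f i}"]) (auto simp: open_cylinder)
qed

text \<open>Such a truth set is clopen; closedness is the half that survives the countable
  conjunctions in the complement of the payoff.\<close>

lemma closed_Collect_locally_constant:
  fixes Q :: "(nat \<Rightarrow> 'b::discrete_topology) \<times> (nat \<Rightarrow> 'c::discrete_topology) \<Rightarrow> bool"
  assumes "\<And>x h. \<exists>n. \<forall>x' h'. (\<forall>i<n. x' i = x i \<and> h' i = h i) \<longrightarrow> Q (x', h') = Q (x, h)"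
  shows "closed {p. Q p}"
proof -
  have "open {p. \<not> Q p}"
  proof (subst open_subopen, clarify)
    fix x h assume nQ: "\<not> Q (x, h)"
    obtain n where n: "\<forall>x' h'. (\<forall>i<n. x' i = x i \<and> h' i = h i) \<longrightarrow> Q (x', h') = Q (x, h)"
      using assms[of x h] by (elim exE)
    let ?T = "{g. \<forall>i<n. g i = x i} \<times> {g. \<forall>i<n. g i = h i}"
    have "\<not> Q p" if "p \<in> ?T" for p
      using n[rule_format, of "fst p" "snd p"] nQ that by (simp add: mem_Times_iff)
    then have "?T \<subseteq> {p. \<not> Q p}"
      by blast
    moreover have "open ?T"
      by (intro open_Times open_cylinder)
    moreover have "(x, h) \<in> ?T"
      by simp
    ultimately show "\<exists>T. open T \<and> (x, h) \<in> T \<and> T \<subseteq> {p. \<not> Q p}"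
      by (intro exI conjI)
  qed
  then show ?thesis
    by (simp add: closed_def Collect_neg_eq)
qed

text \<open>Souslin form of an analytic subset of a sequence space, with finite tests
  \<open>\<Phi>\<close> in place of a closed set.\<close>

definition tree_projection :: "('b list \<Rightarrow> 'c list \<Rightarrow> bool) \<Rightarrow> (nat \<Rightarrow> 'b) set" where
  "tree_projection \<Phi> = {b. \<exists>\<alpha>. \<forall>n. \<Phi> (map b [0..<n]) (map \<alpha> [0..<n])}"

text \<open>Move \<open>n\<close> of player I codes the pair of the \<open>n\<close>-th bit and a digit of the current witness;
  a nonzero move of player II asks for a fresh witness.\<close>

definition bits :: "(nat \<Rightarrow> nat) \<Rightarrow> nat \<Rightarrow> bool" where
  "bits x n \<longleftrightarrow> fst (prod_decode (x (2 * n))) \<noteq> 0"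

definition digits :: "(nat \<Rightarrow> nat) \<Rightarrow> nat \<Rightarrow> nat" where
  "digits x n = snd (prod_decode (x (2 * n)))"

definition switch :: "(nat \<Rightarrow> nat) \<Rightarrow> nat \<Rightarrow> bool" where
  "switch x n \<longleftrightarrow> x (2 * n + 1) \<noteq> 0"

text \<open>Any \<open>N\<close> after the last request may serve as the start of the final witness. This only helps
  player I, and it makes the minimality of \<open>N\<close> superfluous.\<close>

definition switching_payoff :: "(bool list \<Rightarrow> nat list \<Rightarrow> bool) \<Rightarrow> (nat \<Rightarrow> nat) set" where
  "switching_payoff \<Phi> =
     {x. (\<exists>N. (\<forall>n\<ge>N. \<not> switch x n) \<and>
            (\<forall>n. \<Phi> (map (bits x) [0..<n]) (map (\<lambda>i. digits x (N + i)) [0..<n]))) \<or>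
         (infinite {n. switch x n} \<and> bits x \<notin> tree_projection \<Phi>)}"

text \<open>The complement projects a closed set. One \<open>h\<close> stores a bound or a branch
  showing that the second alternative fails and, for each \<open>N\<close>, a number refuting
  \<open>N\<close> as the start of a correct last witness.\<close>

lemma coanalytic_switching_payoff: "coanalytic_set (switching_payoff \<Phi>)"
proof -
  define P where "P N m x \<longleftrightarrow> N \<le> m \<and> switch x m \<or>
      \<not> \<Phi> (map (bits x) [0..<m]) (map (\<lambda>i. digits x (N + i)) [0..<m])" for N m x
  \<comment> \<open>\<open>h 0\<close> bounds the requests; \<open>h (Suc N)\<close> codes the
    number \<open>m\<close> with \<open>P N m x\<close> and the \<open>N\<close>-th digit of the
    branch.\<close>
  define g where "g h N = fst (prod_decode (h (Suc N)))" for h :: "nat \<Rightarrow> nat" and N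
  define \<beta> where "\<beta> h N = snd (prod_decode (h (Suc N)))" for h :: "nat \<Rightarrow> nat" and N
  define C where "C = {p. (\<forall>N. P N (g (snd p) N) (fst p)) \<and>
      ((\<forall>n. snd p 0 \<le> n \<longrightarrow> \<not> switch (fst p) n) \<or>
       (\<forall>n. \<Phi> (map (bits (fst p)) [0..<n]) (map (\<beta> (snd p)) [0..<n])))}"
  have "closed C"
    unfolding C_def
  proof (intro closed_Collect_conj closed_Collect_disj closed_Collect_all
      closed_Collect_locally_constant)
    show "\<exists>n. \<forall>x' h'. (\<forall>i<n. x' i = x i \<and> h' i = h i) \<longrightarrow>
        P N (g (snd (x', h')) N) (fst (x', h')) = P N (g (snd (x, h)) N) (fst (x, h))"
      for N x h
    proof (intro exI allI impI)
      \<comment> \<open>The bound exceeds the index \<open>Suc N\<close> read from \<open>h\<close>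
        and every index of \<open>x\<close> read by the bits, the digits shifted by
        \<open>N\<close>, and the request in round \<open>g h N\<close>.\<close>
      fix x' h' assume a: "\<forall>i<2 * (g h N + N) + N + 2. x' i = x i \<and> h' i = h i"
      then have "g h' N = g h N" by (simp add: g_def)
      moreover have "map (bits x') [0..<g h N] = map (bits x) [0..<g h N]"
        "map (\<lambda>i. digits x' (N + i)) [0..<g h N] = map (\<lambda>i. digits x (N + i)) [0..<g h N]"
        "switch x' (g h N) = switch x (g h N)"
        using a by (auto simp: bits_def digits_def switch_def)
      ultimately show "P N (g (snd (x', h')) N) (fst (x', h')) = P N (g (snd (x, h)) N) (fst (x, h))"
        by (simp add: P_def del: map_eq_conv)
    qed
    show "\<exists>n. \<forall>x' h'. (\<forall>i<n. x' i = x i \<and> h' i = h i) \<longrightarrow>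
        (snd (x', h') 0 \<le> k \<longrightarrow> \<not> switch (fst (x', h')) k) =
        (snd (x, h) 0 \<le> k \<longrightarrow> \<not> switch (fst (x, h)) k)" for k and x h :: "nat \<Rightarrow> nat"
      by (rule exI[of _ "2 * k + 2"]) (auto simp: switch_def)
    show "\<exists>n. \<forall>x' h'. (\<forall>i<n. x' i = x i \<and> h' i = h i) \<longrightarrow>
        \<Phi> (map (bits (fst (x', h'))) [0..<k]) (map (\<beta> (snd (x', h'))) [0..<k]) =
        \<Phi> (map (bits (fst (x, h))) [0..<k]) (map (\<beta> (snd (x, h))) [0..<k])" for k x h
    proof (intro exI allI impI)
      fix x' h' assume a: "\<forall>i<2 * k + 1. x' i = x i \<and> h' i = h i"
      have "map (bits x') [0..<k] = map (bits x) [0..<k]" "map (\<beta> h') [0..<k] = map (\<beta> h) [0..<k]"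
        using a by (auto simp: bits_def \<beta>_def)
      then show "\<Phi> (map (bits (fst (x', h'))) [0..<k]) (map (\<beta> (snd (x', h'))) [0..<k]) =
        \<Phi> (map (bits (fst (x, h))) [0..<k]) (map (\<beta> (snd (x, h))) [0..<k])"
        by (simp del: map_eq_conv)
    qed
  qed
  moreover have "- switching_payoff \<Phi> = fst ` C"
  proof (intro equalityI subsetI)
    fix x assume x: "x \<in> - switching_payoff \<Phi>"
    then have "\<exists>m. P N m x" for N
      unfolding switching_payoff_def P_def by blast
    then obtain m where m: "\<And>N. P N (m N) x" by metis
    have *: "x \<in> fst ` C" if "(\<forall>n\<ge>k. \<not> switch x n) \<or>
        (\<forall>n. \<Phi> (map (bits x) [0..<n]) (map \<alpha> [0..<n]))" for k \<alpha>
    proof -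
      define h where "h n = (case n of 0 \<Rightarrow> k | Suc N \<Rightarrow> prod_encode (m N, \<alpha> N))" for n
      have "g h = m" "\<beta> h = \<alpha>" "h 0 = k" by (auto simp: g_def \<beta>_def h_def)
      then have "(x, h) \<in> C" using that m by (auto simp: C_def)
      then show ?thesis by force
    qed
    show "x \<in> fst ` C"
    proof (cases "finite {n. switch x n}")
      case True
      then obtain k where "\<forall>n\<in>{n. switch x n}. n < k"
        using finite_nat_set_iff_bounded by blast
      \<comment> \<open>With finitely many requests the bound is certificate enough, so the branch
        is arbitrary.\<close>
      then show ?thesis using *[of k undefined] by force
    next
      case False
      then have "bits x \<in> tree_projection \<Phi>"
        using x unfolding switching_payoff_def by blast
      then show ?thesis using * unfolding tree_projection_def by blast
    qed
  next
    fix x assume "x \<in> fst ` C"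
    then obtain h where h: "(x, h) \<in> C" by auto
    have "\<not> (\<forall>n\<ge>N. \<not> switch x n) \<or>
        \<not> (\<forall>n. \<Phi> (map (bits x) [0..<n]) (map (\<lambda>i. digits x (N + i)) [0..<n]))" for N
      using h unfolding C_def P_def by auto
    moreover have "finite {n. switch x n}" if "\<forall>n\<ge>h 0. \<not> switch x n"
      using that by (metis finite_nat_set_iff_bounded mem_Collect_eq not_le)
    then have "finite {n. switch x n} \<or> bits x \<in> tree_projection \<Phi>"
      using h unfolding C_def tree_projection_def by auto
    ultimately show "x \<in> - switching_payoff \<Phi>"
      unfolding switching_payoff_def by blast
  qed
  ultimately show ?thesis
    unfolding coanalytic_set_def analytic_set_def by blast
qed

section \<open>Runs and winning strategies\<close>

lemma run_exists: "\<exists>x :: nat \<Rightarrow> 'b. \<forall>n. x n = G (map x [0..<n])"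
proof -
  \<comment> \<open>Course-of-values recursion: \<open>l n\<close> is the history of the first
    \<open>n\<close> moves.\<close>
  define l where "l = rec_nat [] (\<lambda>_ p. p @ [G p])"
  have l: "l 0 = []" "l (Suc n) = l n @ [G (l n)]" for n
    by (simp_all add: l_def)
  have "map (\<lambda>i. G (l i)) [0..<n] = l n" for n
    by (induction n) (simp_all add: l)
  then show ?thesis by (intro exI[of _ "\<lambda>i. G (l i)"]) simp
qed

text \<open>Source of continuity: rules that differ only on long histories produce the same early
  moves.\<close>

lemma runs_agree:
  assumes "\<And>k. k < n \<Longrightarrow> x k = G (map x [0..<k])" "\<And>k. k < n \<Longrightarrow> x' k = G' (map x' [0..<k])"
    and "\<And>p. length p < n \<Longrightarrow> G p = G' p" and "k < n"
  shows "x k = x' k"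
  using \<open>k < n\<close>
proof (induction k rule: less_induct)
  case (less k)
  then have "map x [0..<k] = map x' [0..<k]" by auto
  then show ?case using assms(1,2)[OF less.prems] assms(3)[of "map x' [0..<k]"] less.prems
    by (metis diff_zero length_map length_upt)
qed

text \<open>Against \<open>\<sigma>\<close>, let II request a fresh witness in round
  \<open>i\<close> exactly when \<open>t i\<close>; the bits played by I form
  \<open>\<phi> t\<close>. Finitely many requests leave only the first winning alternative,
  infinitely many only the second.\<close>

lemma winning_strategy_I_imp_embedding:
  assumes "winning_strategy_I (switching_payoff \<Phi>) \<sigma>"
  shows "\<exists>\<phi>. (\<forall>t t' n. (\<forall>i<n. t i = t' i) \<longrightarrow> \<phi> t n = \<phi> t' n) \<and>
    (\<forall>t. \<phi> t \<in> tree_projection \<Phi> \<longleftrightarrow> finite {i. t i})"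
proof -
  define G where "G t p = (if even (length p) then \<sigma> p else of_bool (t (length p div 2)))"
    for t :: "nat \<Rightarrow> bool" and p
  have "\<forall>t. \<exists>x. \<forall>n. x n = G t (map x [0..<n])"
    by (intro allI run_exists)
  from choice[OF this] obtain x where "\<forall>t n. x t n = G t (map (x t) [0..<n])" ..
  then have x: "x t n = G t (map (x t) [0..<n])" for t n
    by (elim allE)
  have "switch (x t) n = t n" for t n
    unfolding switch_def by (subst x) (simp add: G_def)
  then have sw: "switch (x t) = t" for t
    by (simp add: fun_eq_iff)
  have "x t (2 * n) = \<sigma> (map (x t) [0..<2 * n])" for t n
    by (subst x) (simp add: G_def)
  then have W: "x t \<in> switching_payoff \<Phi>" for t
    using assms[unfolded winning_strategy_I_def, rule_format, of "x t"] by simp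
  show ?thesis
  proof (intro exI[of _ "\<lambda>t. bits (x t)"] conjI allI impI)
    \<comment> \<open>Move \<open>2 * n\<close> of I precedes the move of II in round
      \<open>n\<close>, so it sees only the \<open>t i\<close> with \<open>i < n\<close>.\<close>
    fix t t' :: "nat \<Rightarrow> bool" and n assume a: "\<forall>i<n. t i = t' i"
    have "x t (2 * n) = x t' (2 * n)"
    proof (rule runs_agree[of "2 * n + 1" "x t" "G t" "x t'" "G t'" "2 * n"])
      show "G t p = G t' p" if "length p < 2 * n + 1" for p
      proof (cases "even (length p)")
        case False
        then have "length p div 2 < n" using that by (auto elim!: oddE)
        then show ?thesis using a by (simp add: G_def)
      qed (simp add: G_def)
    qed (rule x | simp)+
    then show "bits (x t) n = bits (x t') n" by (simp add: bits_def)
  next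
    fix t
    show "bits (x t) \<in> tree_projection \<Phi> \<longleftrightarrow> finite {i. t i}"
    proof (cases "finite {i. t i}")
      case True
      then obtain N where "\<forall>n. \<Phi> (map (bits (x t)) [0..<n]) (map (\<lambda>i. digits (x t) (N + i)) [0..<n])"
        using W[of t] by (auto simp: switching_payoff_def sw)
      then have "bits (x t) \<in> tree_projection \<Phi>"
        by (auto simp: tree_projection_def)
      then show ?thesis using True by simp
    next
      case False
      then have "\<not> (\<exists>N. \<forall>n\<ge>N. \<not> t n)"
        by (auto simp: infinite_nat_iff_unbounded_le)
      then have "bits (x t) \<notin> tree_projection \<Phi>"
        using W[of t] unfolding switching_payoff_def mem_Collect_eq sw by meson
      then show ?thesis using False by simp
    qed
  qed
qed

lemma limit_of_list_chain:
  fixes f :: "nat \<Rightarrow> 'b list"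
  assumes len: "\<And>k. length (f k) < length (f (Suc k))"
    and take: "\<And>k. take (length (f k)) (f (Suc k)) = f k"
  obtains x where "\<And>k n. n \<le> length (f k) \<Longrightarrow> map x [0..<n] = take n (f k)"
    and "\<And>k n. n < length (f k) \<Longrightarrow> x n = f k ! n"
proof -
  \<comment> \<open>Lengths grow strictly, so \<open>f (Suc i)\<close> has an entry at index
    \<open>i\<close>.\<close>
  define x where "x i = f (Suc i) ! i" for i
  have mono: "length (f i) \<le> length (f j) \<and> take (length (f i)) (f j) = f i" if "i \<le> j" for i j
    using that
  proof (induction j rule: dec_induct)
    case (step j)
    have "take (length (f i)) (f (Suc j)) = take (length (f i)) (take (length (f j)) (f (Suc j)))"
      using step by (simp add: min_absorb1)
    then show ?case using step len[of j] take[of j] by simp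
  qed simp
  have ge: "k \<le> length (f k)" for k
  proof (induction k)
    case (Suc k)
    then show ?case using len[of k] by simp
  qed simp
  have x: "x n = f k ! n" if "n < length (f k)" for k n
  proof (cases "k \<le> Suc n")
    case True
    then have "f k = take (length (f k)) (f (Suc n))" using mono[of k "Suc n"] by simp
    then have "f k ! n = take (length (f k)) (f (Suc n)) ! n" by simp
    then show ?thesis using that by (simp add: x_def)
  next
    case False
    then have "f (Suc n) = take (length (f (Suc n))) (f k)" using mono[of "Suc n" k] by simp
    then have "f (Suc n) ! n = take (length (f (Suc n))) (f k) ! n" by simp
    then show ?thesis using ge[of "Suc n"] by (simp add: x_def)
  qed
  have "map x [0..<n] = take n (f k)" if "n \<le> length (f k)" for k n
    using that by (intro nth_equalityI) (auto simp: x)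
  then show thesis using x that by blast
qed

text \<open>For a position \<open>p\<close>, the set \<open>K p\<close> holds the \<open>b\<close>
  along which \<open>\<tau>\<close> never asks again after \<open>p\<close>, whatever digits I
  plays. If such a \<open>b\<close> were in the projection, I would win by playing a witness from
  \<open>p\<close> on. If a \<open>b\<close> outside the projection lay in no \<open>K p\<close>,
  requests could be provoked forever and I would win by the second alternative.\<close>

lemma winning_strategy_II_imp_sigma_closed:
  assumes win: "winning_strategy_II (switching_payoff \<Phi>) \<tau>"
  shows "\<exists>K :: nat \<Rightarrow> (nat \<Rightarrow> bool) set. (\<forall>n. closed (K n)) \<and> (\<Union>n. K n) = - tree_projection \<Phi>"
proof -
  \<comment> \<open>The rule replays \<open>p\<close>; then I codes \<open>b\<close> together with
    \<open>\<alpha>\<close> started at the end of \<open>p\<close>, and II obeys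
    \<open>\<tau>\<close>.\<close>
  define G where "G p b \<alpha> q =
      (if length q < length p then p ! length q
       else if even (length q)
       then prod_encode (of_bool (b (length q div 2)), \<alpha> (length q div 2 - length p div 2))
       else \<tau> q)" for p and b :: "nat \<Rightarrow> bool" and \<alpha> :: "nat \<Rightarrow> nat" and q
  define r where "r p b \<alpha> = (SOME x. \<forall>n. x n = G p b \<alpha> (map x [0..<n]))" for p b \<alpha>
  have "\<forall>n. r p b \<alpha> n = G p b \<alpha> (map (r p b \<alpha>) [0..<n])" for p b \<alpha>
    unfolding r_def by (rule someI_ex[OF run_exists[of "G p b \<alpha>"]])
  then have r: "r p b \<alpha> n = G p b \<alpha> (map (r p b \<alpha>) [0..<n])" for p b \<alpha> n
    by (rule spec)
  \<comment> \<open>Even length: I is to move, so a fresh witness starts with a full round.\<close>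
  define legal where "legal p \<longleftrightarrow>
      even (length p) \<and> (\<forall>n. 2 * n + 1 < length p \<longrightarrow> p ! (2 * n + 1) = \<tau> (take (2 * n + 1) p))" for p
  define follows where "follows p b \<longleftrightarrow>
      (\<forall>n. 2 * n < length p \<longrightarrow> b n = (fst (prod_decode (p ! (2 * n))) \<noteq> 0))"
    for p and b :: "nat \<Rightarrow> bool"
  define K where "K p = {b. legal p \<and> follows p b \<and>
      (\<forall>\<alpha>. \<forall>n\<ge>length p div 2. \<not> switch (r p b \<alpha>) n)}" for p

  have r_nth: "r p b \<alpha> n = p ! n" if "n < length p" for p b \<alpha> n
    using that by (subst r) (simp add: G_def)
  have r_take: "map (r p b \<alpha>) [0..<n] = take n p" if "n \<le> length p" for p b \<alpha> n
    using that by (intro nth_equalityI) (auto simp: r_nth)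
  have r_odd: "r p b \<alpha> (2 * n + 1) = \<tau> (map (r p b \<alpha>) [0..<2 * n + 1])" if "legal p" for p b \<alpha> n
  proof (cases "2 * n + 1 < length p")
    case True
    then show ?thesis using that r_nth[OF True] r_take[of "2 * n + 1" p] unfolding legal_def by auto
  next
    case False
    then show ?thesis by (subst r) (simp add: G_def)
  qed
  have r_even: "r p b \<alpha> (2 * n) = prod_encode (of_bool (b n), \<alpha> (n - length p div 2))"
    if "length p \<le> 2 * n" for p b \<alpha> n
    using that by (subst r) (simp add: G_def)
  have r_bits: "bits (r p b \<alpha>) = b" if "follows p b" for p b \<alpha>
  proof
    fix n show "bits (r p b \<alpha>) n = b n"
      using that by (cases "2 * n < length p") (auto simp: bits_def r_nth r_even follows_def)
  qed
  have r_digits: "digits (r p b \<alpha>) (length p div 2 + i) = \<alpha> i" if "legal p" for p b \<alpha> i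
  proof -
    have "even (length p)" using that by (simp add: legal_def)
    then have "length p \<le> 2 * (length p div 2 + i)" by auto
    then show ?thesis using r_even[of p "length p div 2 + i"] by (simp add: digits_def)
  qed
  have r_cong: "r p b \<alpha> k = r p b' \<alpha> k" if "\<forall>i<n. b i = b' i" "k < 2 * n" for p b b' \<alpha> n k
  proof (rule runs_agree[of "2 * n" "r p b \<alpha>" "G p b \<alpha>" "r p b' \<alpha>" "G p b' \<alpha>"])
    show "G p b \<alpha> q = G p b' \<alpha> q" if q: "length q < 2 * n" for q
    proof -
      have "length q div 2 < n" using q by auto
      then show ?thesis using \<open>\<forall>i<n. b i = b' i\<close> by (simp add: G_def)
    qed
  qed (rule r | rule that)+
  have r_not_win: "r p b \<alpha> \<notin> switching_payoff \<Phi>" if "legal p" for p b \<alpha>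
    using win[unfolded winning_strategy_II_def, rule_format, of "r p b \<alpha>"] r_odd[OF that] by simp

  have "closed (K p)" for p
    unfolding closed_def
  proof (rule open_if_cylinders)
    fix b assume b: "b \<in> - K p"
    consider "\<not> legal p" | n where "2 * n < length p" "b n \<noteq> (fst (prod_decode (p ! (2 * n))) \<noteq> 0)"
      | \<alpha> n where "n \<ge> length p div 2" "switch (r p b \<alpha>) n"
      using b unfolding K_def follows_def by blast
    then show "\<exists>n. \<forall>b'. (\<forall>i<n. b' i = b i) \<longrightarrow> b' \<in> - K p"
    proof cases
      case 1
      then show ?thesis by (simp add: K_def)
    next
      case 2
      then show ?thesis by (intro exI[of _ "Suc n"]) (auto simp: K_def follows_def)
    next
      case 3
      show ?thesis
      proof (intro exI allI impI)
        fix b' assume "\<forall>i<Suc n. b' i = b i"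
        \<comment> \<open>The same \<open>\<alpha>\<close> provokes the same request, as the run up
          to move \<open>2 * n + 1\<close> uses only the first \<open>Suc n\<close> bits.\<close>
        then have "r p b' \<alpha> (2 * n + 1) = r p b \<alpha> (2 * n + 1)"
          by (rule r_cong) simp
        then have "switch (r p b' \<alpha>) n" using 3 by (simp add: switch_def)
        then show "b' \<in> - K p" using 3 by (auto simp: K_def)
      qed
    qed
  qed
  moreover have "b \<notin> tree_projection \<Phi>" if b: "b \<in> K p" for b p
  proof
    assume "b \<in> tree_projection \<Phi>"
    then obtain \<alpha> where \<alpha>: "\<forall>n. \<Phi> (map b [0..<n]) (map \<alpha> [0..<n])"
      unfolding tree_projection_def by blast
    have p: "legal p" "follows p b" and ns: "\<forall>n\<ge>length p div 2. \<not> switch (r p b \<alpha>) n"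
      using b by (auto simp: K_def)
    have "\<forall>n. \<Phi> (map (bits (r p b \<alpha>)) [0..<n])
        (map (\<lambda>i. digits (r p b \<alpha>) (length p div 2 + i)) [0..<n])"
      using \<alpha> by (simp add: r_bits[OF p(2)] r_digits[OF p(1)])
    then have "r p b \<alpha> \<in> switching_payoff \<Phi>"
      using ns unfolding switching_payoff_def by blast
    then show False using r_not_win[OF p(1)] by simp
  qed
  moreover have "\<exists>p. b \<in> K p" if b: "b \<notin> tree_projection \<Phi>" for b
  proof (rule ccontr)
    assume none: "\<nexists>p. b \<in> K p"
    have step: "\<exists>q. (legal q \<and> follows q b) \<and> length p < length q \<and> take (length p) q = p \<and>
        (\<exists>n. length p \<le> 2 * n + 1 \<and> 2 * n + 1 < length q \<and> q ! (2 * n + 1) \<noteq> 0)"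
      if p: "legal p \<and> follows p b" for p
    proof -
      obtain \<alpha> n where n: "n \<ge> length p div 2" "switch (r p b \<alpha>) n"
        using none p unfolding K_def by blast
      define x where "x = r p b \<alpha>"
      \<comment> \<open>The run is cut just after the provoked request, so I is to move
        again.\<close>
      define q where "q = map x [0..<2 * n + 2]"
      have le: "length p \<le> 2 * n + 1" using n by linarith
      have len: "length q = 2 * n + 2" by (simp add: q_def)
      have q_nth: "q ! i = x i" if "i < 2 * n + 2" for i
        using that unfolding q_def by (metis add_0 diff_zero length_upt nth_map nth_upt)
      have q_take: "take i q = map x [0..<i]" if "i \<le> 2 * n + 2" for i
        using that unfolding q_def by (simp add: take_map take_upt del: upt_Suc)
      have "legal q"
        unfolding legal_def
      proof (intro conjI allI impI)
        fix m assume "2 * m + 1 < length q"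
        then show "q ! (2 * m + 1) = \<tau> (take (2 * m + 1) q)"
          using q_nth[of "2 * m + 1"] q_take[of "2 * m + 1"] r_odd[of p b \<alpha> m] p
          by (simp add: len x_def)
      qed (simp add: len)
      moreover have "follows q b"
        unfolding follows_def
      proof (intro allI impI)
        fix m assume "2 * m < length q"
        then show "b m = (fst (prod_decode (q ! (2 * m))) \<noteq> 0)"
          using fun_cong[OF r_bits[of p b \<alpha>], of m] p q_nth[of "2 * m"]
          by (simp add: len x_def bits_def)
      qed
      moreover have "take (length p) q = p"
        using q_take[of "length p"] r_take[of "length p" p b \<alpha>] le by (simp add: x_def)
      moreover have "q ! (2 * n + 1) \<noteq> 0"
        using n(2) q_nth[of "2 * n + 1"] by (simp add: switch_def x_def)
      moreover have "length p < length q" "2 * n + 1 < length q"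
        using le by (simp_all add: len)
      ultimately show ?thesis using le by blast
    qed
    \<comment> \<open>Dependent choice gives growing legal positions, each gaining a request; the
      limit is a run that obeys \<open>\<tau>\<close> and yet is won by I.\<close>
    have "\<exists>f. \<forall>k. (legal (f k) \<and> follows (f k) b) \<and>
        (length (f k) < length (f (Suc k)) \<and> take (length (f k)) (f (Suc k)) = f k \<and>
        (\<exists>n. length (f k) \<le> 2 * n + 1 \<and> 2 * n + 1 < length (f (Suc k)) \<and> f (Suc k) ! (2 * n + 1) \<noteq> 0))"
    proof (rule dependent_nat_choice)
      show "\<exists>p. legal p \<and> follows p b"
        by (rule exI[of _ "[]"]) (simp add: legal_def follows_def)
    qed (rule step)
    then obtain f where legal: "\<And>k. legal (f k)" and follows: "\<And>k. follows (f k) b"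
      and len: "\<And>k. length (f k) < length (f (Suc k))"
      and tk: "\<And>k. take (length (f k)) (f (Suc k)) = f k"
      and sw: "\<And>k. \<exists>n. length (f k) \<le> 2 * n + 1 \<and> 2 * n + 1 < length (f (Suc k)) \<and>
          f (Suc k) ! (2 * n + 1) \<noteq> 0"
      by metis
    obtain x where x_map: "\<And>k n. n \<le> length (f k) \<Longrightarrow> map x [0..<n] = take n (f k)"
      and x_nth: "\<And>k n. n < length (f k) \<Longrightarrow> x n = f k ! n"
      using limit_of_list_chain[of f, OF len tk] by blast
    have ge: "k \<le> length (f k)" for k
    proof (induction k)
      case (Suc k)
      then show ?case using len[of k] by simp
    qed simp
    have "x (2 * n + 1) = \<tau> (map x [0..<2 * n + 1])" for n
    proof -
      have l: "2 * n + 1 < length (f (2 * n + 2))" using ge[of "2 * n + 2"] by simp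
      then have "x (2 * n + 1) = f (2 * n + 2) ! (2 * n + 1)" by (rule x_nth)
      also have "\<dots> = \<tau> (take (2 * n + 1) (f (2 * n + 2)))"
        using legal[of "2 * n + 2"] l unfolding legal_def by blast
      also have "take (2 * n + 1) (f (2 * n + 2)) = map x [0..<2 * n + 1]"
        using l by (intro x_map[symmetric]) simp
      finally show ?thesis .
    qed
    then have "x \<notin> switching_payoff \<Phi>"
      using win unfolding winning_strategy_II_def by simp
    moreover have "bits x = b"
    proof
      fix n
      have l: "2 * n < length (f (2 * n + 1))" using ge[of "2 * n + 1"] by simp
      then show "bits x n = b n"
        using follows[of "2 * n + 1"] x_nth[OF l] by (simp add: follows_def bits_def)
    qed
    moreover have "\<exists>n\<ge>m. switch x n" for m
    proof -
      \<comment> \<open>\<open>f (2 * m + 1)\<close> has at least \<open>2 * m + 1\<close> entries,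
        so the request gained next falls in round \<open>m\<close> or later.\<close>
      obtain n where n: "length (f (2 * m + 1)) \<le> 2 * n + 1" "2 * n + 1 < length (f (Suc (2 * m + 1)))"
          "f (Suc (2 * m + 1)) ! (2 * n + 1) \<noteq> 0"
        using sw[of "2 * m + 1"] by blast
      have "n \<ge> m" using n(1) ge[of "2 * m + 1"] by simp
      moreover have "switch x n" using n(3) x_nth[OF n(2)] by (simp add: switch_def)
      ultimately show ?thesis by blast
    qed
    then have "infinite {n. switch x n}"
      by (simp add: infinite_nat_iff_unbounded_le)
    ultimately show False
      using b unfolding switching_payoff_def by simp
  qed
  \<comment> \<open>Positions are lists of numbers, so \<open>from_nat\<close> reaches all of
    them.\<close>
  ultimately have "(\<forall>n. closed (K (from_nat n))) \<and> (\<Union>n. K (from_nat n)) = - tree_projection \<Phi>"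
    by (auto, metis from_nat_to_nat)
  then show ?thesis by (rule exI[of _ "\<lambda>n. K (from_nat n)"])
qed

text \<open>The cases correspond to the player who wins. In the first, \<open>\<phi>\<close>
  continuously reduces the eventually false sequences to the analytic set; in the second, the closed
  pieces are compact because Cantor space is.\<close>

theorem coanalytic_Hurewicz_dichotomy:
  fixes \<Phi> :: "bool list \<Rightarrow> nat list \<Rightarrow> bool"
  assumes coanalytic_determinacy
  obtains (embedding) \<phi> :: "(nat \<Rightarrow> bool) \<Rightarrow> nat \<Rightarrow> bool"
    where "\<And>t t' n. \<forall>i<n. t i = t' i \<Longrightarrow> \<phi> t n = \<phi> t' n"
      and "\<And>t. \<phi> t \<in> tree_projection \<Phi> \<longleftrightarrow> finite {i. t i}"
  | (sigma_compact) K :: "nat \<Rightarrow> (nat \<Rightarrow> bool) set"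
    where "\<And>n. closed (K n)" "(\<Union>n. K n) = - tree_projection \<Phi>"
proof -
  have "determined (switching_payoff \<Phi>)"
    using assms coanalytic_switching_payoff unfolding coanalytic_determinacy_def by blast
  then show thesis
    using winning_strategy_I_imp_embedding[of \<Phi>] winning_strategy_II_imp_sigma_closed[of \<Phi>] that
    unfolding determined_def by metis
qed

section \<open>K-analytic remainders\<close>

text \<open>Regularity shrinks \<open>G\<close> around each of its points; countably many preimages
  of the shrunken sets cover the Lindelof set \<open>S\<close>.\<close>

lemma Lindelof_closure_cover:
  assumes lin: "Lindelof_space (subtopology X S)" and "S \<subseteq> topspace X"
    and e: "continuous_map X Y e" and reg: "regular_space Y"
    and G: "openin Y G" "e ` S \<subseteq> G"
  obtains V :: "nat \<Rightarrow> 'b set"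
  where "\<And>j. openin Y (V j)" "\<And>j. Y closure_of V j \<subseteq> G" "e ` S \<subseteq> (\<Union>j. V j)"
proof -
  define \<O> where "\<O> = {U. openin Y U \<and> Y closure_of U \<subseteq> G}"
  define pre where "pre U = {x \<in> topspace X. e x \<in> U}" for U
  have "\<exists>U\<in>\<O>. y \<in> U" if y: "y \<in> G" for y
  proof -
    obtain U V where "openin Y U" "closedin Y V" "y \<in> U" "U \<subseteq> V" "V \<subseteq> G"
      using reg G(1) y unfolding neighbourhood_base_of_closedin[symmetric] neighbourhood_base_of
      by metis
    moreover have "Y closure_of U \<subseteq> V"
      using \<open>closedin Y V\<close> \<open>U \<subseteq> V\<close> by (rule closure_of_minimal[rotated])
    ultimately show ?thesis unfolding \<O>_def by blast
  qed
  then have "S \<subseteq> \<Union> (pre ` \<O>)"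
    using G(2) \<open>S \<subseteq> topspace X\<close> unfolding pre_def by blast
  moreover have "\<forall>U\<in>pre ` \<O>. openin X U"
    using e unfolding pre_def \<O>_def by (auto intro: openin_continuous_map_preimage)
  ultimately obtain \<W> where "countable \<W>" "\<W> \<subseteq> pre ` \<O>" "S \<subseteq> \<Union> \<W>"
    using lin unfolding Lindelof_space_subtopology_subset[OF \<open>S \<subseteq> topspace X\<close>] by metis
  then obtain \<V> where V: "countable \<V>" "\<V> \<subseteq> \<O>" "S \<subseteq> \<Union> (pre ` \<V>)"
    by (metis countable_subset_image)
  \<comment> \<open>Adding the empty set makes the family nonempty, as its enumeration
    requires.\<close>
  have cnt: "range (from_nat_into (insert {} \<V>)) = insert {} \<V>"
    using V(1) by (intro range_from_nat_into) auto
  have sub: "insert {} \<V> \<subseteq> \<O>"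
    using V(2) by (auto simp: \<O>_def)
  have *: "from_nat_into (insert {} \<V>) j \<in> \<O>" for j
    using sub cnt by blast
  show thesis
  proof
    show "openin Y (from_nat_into (insert {} \<V>) j)"
      "Y closure_of from_nat_into (insert {} \<V>) j \<subseteq> G" for j
      using *[of j] by (auto simp: \<O>_def)
    show "e ` S \<subseteq> (\<Union>j. from_nat_into (insert {} \<V>) j)"
      using V(3) unfolding cnt pre_def by auto
  qed
qed

text \<open>Inside its Stone-Cech compactification, \<open>Z\<close> is an intersection of open sets
  \<open>G n\<close>, and \<open>A s\<close> picks members of countable covers of \<open>Z\<close>
  with closures in these. Along a branch the closures meet in a compact subset of \<open>Z\<close>;
  its image in \<open>R\<close> is separated from any point off \<open>R\<close>, which therefore
  drops out of some \<open>F (map \<alpha> [0..<n])\<close>.\<close>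

lemma K_analytic_Souslin_scheme:
  fixes Y :: "'b topology"
  assumes Haus: "Hausdorff_space Y" and R: "R \<subseteq> topspace Y"
    and "K_analytic_space TYPE('z) (subtopology Y R)"
  shows "\<exists>F :: nat list \<Rightarrow> 'b set. (\<forall>s. closedin Y (F s)) \<and> (\<forall>s j. F (s @ [j]) \<subseteq> F s) \<and>
    R = (\<Union>\<alpha>. \<Inter>n. F (map \<alpha> [0..<n]))"
proof -
  obtain Z :: "'z topology" and f where Z: "Lindelof_space Z" "Cech_complete_space Z"
    and f: "continuous_map Z (subtopology Y R) f" and surj: "f ` topspace Z = R"
    using assms(3) R unfolding K_analytic_space_def by (auto simp: Int_absorb1)
  define S where "S = stone_cech Z"
  define e where "e = stone_cech_map Z"
  have emb: "embedding_map Z S e"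
    using Z(2) unfolding S_def e_def Cech_complete_space_def
    by (blast intro: embedding_map_stone_cech_map)
  then have hom: "homeomorphic_map Z (subtopology S (e ` topspace Z)) e"
    by (simp add: embedding_map_def)
  have e: "continuous_map Z S e"
    using homeomorphic_imp_continuous_map[OF hom] by (simp add: continuous_map_in_subtopology)
  have S: "compact_space S" "Hausdorff_space S"
    unfolding S_def by (rule compact_stone_cech Hausdorff_stone_cech)+
  have reg: "regular_space S"
    using S by (rule compact_Hausdorff_imp_regular_space)
  obtain G where G: "\<And>n::nat. openin S (G n)" "(\<Inter>n. G n) = e ` topspace Z"
    using Z(2) unfolding Cech_complete_space_def gdelta_in_descending S_def e_def by blast
  have "\<exists>V :: nat \<Rightarrow> _. (\<forall>j. openin S (V j) \<and> S closure_of V j \<subseteq> G n) \<and>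
      e ` topspace Z \<subseteq> (\<Union>j. V j)" for n
  proof -
    have "Lindelof_space (subtopology Z (topspace Z))" "e ` topspace Z \<subseteq> G n"
      using Z(1) G(2) by auto
    then obtain V :: "nat \<Rightarrow> _" where "\<And>j. openin S (V j)" "\<And>j. S closure_of V j \<subseteq> G n"
        "e ` topspace Z \<subseteq> (\<Union>j. V j)"
      using Lindelof_closure_cover[OF _ subset_refl e reg G(1)] by metis
    then show ?thesis by blast
  qed
  then obtain V where V: "\<And>n j::nat. openin S (V n j)" "\<And>n j. S closure_of V n j \<subseteq> G n"
      "\<And>n. e ` topspace Z \<subseteq> (\<Union>j. V n j)"
    by metis
  define A where "A s = {z \<in> topspace Z. \<forall>i<length s. e z \<in> V i (s ! i)}" for s
  define F where "F s = Y closure_of (f ` A s)" for s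
  have A_top: "A s \<subseteq> topspace Z" for s
    by (auto simp: A_def)
  have fY: "f ` A s \<subseteq> topspace Y" for s
    using surj R A_top by blast
  show ?thesis
  proof (intro exI[of _ F] conjI allI)
    show "closedin Y (F s)" for s by (simp add: F_def)
    show "F (s @ [j]) \<subseteq> F s" for s j
      unfolding F_def by (intro closure_of_mono image_mono) (auto simp: A_def nth_append)
    show "R = (\<Union>\<alpha>. \<Inter>n. F (map \<alpha> [0..<n]))"
    proof (intro equalityI subsetI)
      fix y assume "y \<in> R"
      then obtain z where z: "z \<in> topspace Z" "y = f z" using surj by blast
      then have "\<forall>n. \<exists>j. e z \<in> V n j" using V(3) by blast
      then obtain \<alpha> where "\<And>n. e z \<in> V n (\<alpha> n)" by metis
      then have "z \<in> A (map \<alpha> [0..<n])" for n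
        using z by (simp add: A_def)
      then have "y \<in> F (map \<alpha> [0..<n])" for n
        unfolding F_def using z(2) closure_of_subset[OF fY] by blast
      then show "y \<in> (\<Union>\<alpha>. \<Inter>n. F (map \<alpha> [0..<n]))" by blast
    next
      fix y assume "y \<in> (\<Union>\<alpha>. \<Inter>n. F (map \<alpha> [0..<n]))"
      then obtain \<alpha> where \<alpha>: "\<And>n. y \<in> F (map \<alpha> [0..<n])" by blast
      have yY: "y \<in> topspace Y"
        using \<alpha>[of 0] by (simp add: F_def in_closure_of)
      show "y \<in> R"
      proof (rule ccontr)
        assume yR: "y \<notin> R"
        \<comment> \<open>Inserting \<open>topspace S\<close> keeps \<open>W 0\<close> inside the
          space.\<close>
        define W where "W n = \<Inter> (insert (topspace S) ((\<lambda>i. S closure_of V i (\<alpha> i)) ` {..<n}))" for n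
        have W_closed: "closedin S (W n)" for n
          unfolding W_def by (intro closedin_Inter) auto
        have W_sub: "(\<Inter>n. W n) \<subseteq> e ` topspace Z"
          unfolding G(2)[symmetric] using V(2) by (fastforce simp: W_def)
        \<comment> \<open>By \<open>W_sub\<close>, \<open>H\<close> is the copy in \<open>Z\<close>
          of the compact intersection of all \<open>W n\<close>.\<close>
        define H where "H = {z \<in> topspace Z. e z \<in> (\<Inter>n. W n)}"
        have eH: "e ` H = (\<Inter>n. W n)"
          using W_sub by (auto simp: H_def)
        have "closedin S (\<Inter>n. W n)"
          using W_closed by (intro closedin_Inter) auto
        then have "compactin S (e ` H)"
          unfolding eH using S(1) by (rule closedin_compact_space[rotated])
        then have "compactin (subtopology S (e ` topspace Z)) (e ` H)"
          by (auto simp: compactin_subtopology H_def)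
        then have "compactin Z H"
          using homeomorphic_map_compactness[OF hom, of H] by (auto simp: H_def)
        then have "compactin (subtopology Y R) (f ` H)"
          using f by (rule image_compactin)
        then have "compactin Y (f ` H)"
          by (simp add: compactin_subtopology)
        moreover have "compactin Y {y}"
          using yY by simp
        moreover have "disjnt {y} (f ` H)"
          using yR surj by (auto simp: H_def)
        ultimately obtain U O' where UO: "openin Y U" "openin Y O'" "{y} \<subseteq> U" "f ` H \<subseteq> O'" "disjnt U O'"
          using Hausdorff_space_compact_separation[OF Haus] by metis
        have "openin Z {z \<in> topspace Z. f z \<in> O'}"
          using f UO(2) by (metis continuous_map_in_subtopology openin_continuous_map_preimage)
        then have "openin (subtopology S (e ` topspace Z)) (e ` {z \<in> topspace Z. f z \<in> O'})"
          using homeomorphic_imp_open_map[OF hom] by (simp add: open_map_def)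
        then obtain T where T: "openin S T" "e ` {z \<in> topspace Z. f z \<in> O'} = T \<inter> e ` topspace Z"
          by (auto simp: openin_subtopology)
        have inj: "inj_on e (topspace Z)"
          using hom by (simp add: homeomorphic_map_def)
        have T_pre: "f z \<in> O'" if "z \<in> topspace Z" "e z \<in> T" for z
        proof -
          have "e z \<in> e ` {z \<in> topspace Z. f z \<in> O'}" using T(2) that by blast
          then show ?thesis using inj that by (auto simp: inj_on_def)
        qed
        \<comment> \<open>Otherwise compactness gives a point of all \<open>W n\<close> outside
          \<open>T\<close>; it comes from \<open>H\<close>, which \<open>f\<close> maps into
          \<open>O'\<close>.\<close>
        have "\<exists>n. W n - T = {}"
        proof (rule ccontr)
          assume "\<nexists>n. W n - T = {}"
          moreover have "decseq (\<lambda>n. W n - T)"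
            by (rule decseq_SucI) (auto simp: W_def)
          moreover have "closedin S (W n - T)" for n
            using W_closed T(1) by (intro closedin_diff)
          ultimately have "(\<Inter>n. W n - T) \<noteq> {}"
            using S(1) by (intro compact_space_imp_nest) auto
          then obtain w where w: "w \<in> (\<Inter>n. W n)" "w \<notin> T" by auto
          then obtain z where "z \<in> H" "w = e z" using eH by blast
          then have "w \<in> e ` {z \<in> topspace Z. f z \<in> O'}" using UO(4) by (auto simp: H_def)
          then show False using w T(2) by blast
        qed
        then obtain n where n: "W n \<subseteq> T" by blast
        have "f ` A (map \<alpha> [0..<n]) \<subseteq> O'"
        proof clarify
          fix z assume z: "z \<in> A (map \<alpha> [0..<n])"
          have "e z \<in> W n"
            unfolding W_def
          proof (intro InterI, elim insertE imageE)
            show "e z \<in> B" if "B = topspace S" for B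
              using that e z A_top by (auto simp: continuous_map_def Pi_iff)
            show "e z \<in> B" if "i \<in> {..<n}" "B = S closure_of V i (\<alpha> i)" for B i
            proof -
              have "e z \<in> V i (\<alpha> i)" using z that(1) by (auto simp: A_def)
              then show ?thesis
                using that(2) closure_of_subset[OF openin_subset[OF V(1)]] by blast
            qed
          qed
          then show "f z \<in> O'" using n z A_top T_pre by blast
        qed
        moreover have "\<exists>x\<in>f ` A (map \<alpha> [0..<n]). x \<in> U"
          using \<alpha>[of n] UO(1,3) unfolding F_def in_closure_of by blast
        ultimately show False
          using UO(5) by (auto simp: disjnt_def)
      qed
    qed
  qed
qed

section \<open>Menger spaces\<close>

text \<open>Apply the Menger property to a constant sequence of covers.\<close>

lemma Menger_imp_Lindelof_space:
  assumes "Menger_space X"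
  shows "Lindelof_space X"
  unfolding Lindelof_space_def
proof (intro allI impI)
  fix \<U> assume "(\<forall>U\<in>\<U>. openin X U) \<and> \<Union> \<U> = topspace X"
  then have "\<exists>\<V> :: nat \<Rightarrow> 'a set set.
      (\<forall>n. finite (\<V> n) \<and> \<V> n \<subseteq> \<U>) \<and> \<Union> (\<Union>n. \<V> n) = topspace X"
    using assms[unfolded Menger_space_def, THEN spec, of "\<lambda>_. \<U>"] by simp
  then obtain \<V> :: "nat \<Rightarrow> 'a set set"
    where \<V>: "\<forall>n. finite (\<V> n) \<and> \<V> n \<subseteq> \<U>" "\<Union> (\<Union>n. \<V> n) = topspace X"
    by (elim exE conjE)
  then show "\<exists>\<V>. countable \<V> \<and> \<V> \<subseteq> \<U> \<and> \<Union> \<V> = topspace X"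
    by (intro exI[of _ "\<Union>n. \<V> n"]) (auto intro: countable_finite)
qed

lemma Lindelof_fsigma_in_subtopology:
  assumes "Lindelof_space X" "fsigma_in X S"
  shows "Lindelof_space (subtopology X S)"
proof -
  obtain \<C> where \<C>: "countable \<C>" "\<And>C. C \<in> \<C> \<Longrightarrow> closedin X C" "\<Union> \<C> = S"
    using assms(2) unfolding fsigma_in_def union_of_def by auto
  show ?thesis
    unfolding \<C>(3)[symmetric]
    by (intro Lindelof_space_Union Lindelof_space_closedin_subtopology assms(1) \<C>)
qed

text \<open>A finite part of an increasing cover lies in one member, so the selection reduces to one
  index per cover.\<close>

lemma Menger_spaceD_increasing:
  assumes "Menger_space X" and U: "\<And>k m::nat. openin X (U k m)"
    and mono: "\<And>k m n. m \<le> n \<Longrightarrow> U k m \<subseteq> U k n" and cover: "\<And>k::nat. (\<Union>m. U k m) = topspace X"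
  obtains m where "(\<Union>k. U k (m k)) = topspace X"
proof -
  have "\<exists>\<V> :: nat \<Rightarrow> 'a set set.
      (\<forall>k. finite (\<V> k) \<and> \<V> k \<subseteq> range (U k)) \<and> \<Union> (\<Union>k. \<V> k) = topspace X"
    by (rule assms(1)[unfolded Menger_space_def, THEN spec, of "\<lambda>k. range (U k)", THEN mp])
       (use U cover in auto)
  then obtain \<V> :: "nat \<Rightarrow> 'a set set"
    where \<V>: "\<forall>k. finite (\<V> k) \<and> \<V> k \<subseteq> range (U k)" "\<Union> (\<Union>k. \<V> k) = topspace X"
    by (elim exE conjE)
  have "\<exists>m. \<Union> (\<V> k) \<subseteq> U k m" for k
  proof -
    obtain I where I: "finite I" "\<V> k = U k ` I"
      using \<V>(1) finite_subset_image[of "\<V> k" "U k" UNIV] by auto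
    then obtain m where "\<forall>i\<in>I. i \<le> m"
      using finite_nat_set_iff_bounded_le by blast
    then have "\<Union> (\<V> k) \<subseteq> U k m"
      using mono unfolding I(2) by blast
    then show ?thesis by blast
  qed
  then obtain m where "\<And>k. \<Union> (\<V> k) \<subseteq> U k (m k)" by metis
  then have "topspace X \<subseteq> (\<Union>k. U k (m k))"
    unfolding \<V>(2)[symmetric] by blast
  moreover have "(\<Union>k. U k (m k)) \<subseteq> topspace X"
    using openin_subset[OF U] by blast
  ultimately show thesis using that by blast
qed

section \<open>Cantor space: projections and sparse sequences\<close>

lemma compact_space_Cantor: "compact_space (euclidean :: (nat \<Rightarrow> bool) topology)"
proof -
  have "compact_space (euclidean :: bool topology)"
    by (simp add: compact_space_def finite_imp_compact)
  then show ?thesis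
    unfolding euclidean_product_topology[symmetric] by (simp add: compact_space_product_topology)
qed

text \<open>Projection along the compact Cantor factor is a closed map. Letting
  \<open>\<phi> t n\<close> depend on \<open>t n\<close> as well admits the identity as
  \<open>\<phi>\<close>.\<close>

lemma closedin_Cantor_projection:
  fixes \<phi> :: "(nat \<Rightarrow> bool) \<Rightarrow> nat \<Rightarrow> bool"
  assumes D: "\<And>i c. closedin Y (D i c)" and K: "closed K"
    and \<phi>: "\<And>t t' n. \<forall>i\<le>n. t i = t' i \<Longrightarrow> \<phi> t n = \<phi> t' n"
  shows "closedin Y {y \<in> topspace Y. \<exists>t\<in>K. \<forall>i. y \<in> D i (\<phi> t i)}"
proof -
  let ?P = "prod_topology (euclidean :: (nat \<Rightarrow> bool) topology) Y"
  define E where "E i c = {t. \<phi> t i = c} \<times> D i c" for i c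
  have "closed {t. \<phi> t i = c}" for i c
  proof -
    have "open {t. \<phi> t i \<noteq> c}"
    proof (rule open_if_cylinders, intro exI allI impI)
      fix t t' assume "t \<in> {t. \<phi> t i \<noteq> c}" "\<forall>j<Suc i. t' j = t j"
      then show "t' \<in> {t. \<phi> t i \<noteq> c}" using \<phi>[of i t' t] by (simp add: less_Suc_eq_le)
    qed
    then show ?thesis unfolding closed_def Collect_neg_eq .
  qed
  then have "closedin ?P (E i c)" for i c
    unfolding E_def using D by (simp add: closedin_prod_Times_iff)
  then have "closedin ?P (E i True \<union> E i False)" for i
    by (intro closedin_Un)
  moreover have "closedin ?P (K \<times> topspace Y)"
    using K by (simp add: closedin_prod_Times_iff)
  ultimately have "closedin ?P (\<Inter> (insert (K \<times> topspace Y) (range (\<lambda>i. E i True \<union> E i False))))"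
    by (intro closedin_Inter) auto
  moreover have "{y \<in> topspace Y. \<exists>t\<in>K. \<forall>i. y \<in> D i (\<phi> t i)} =
      snd ` \<Inter> (insert (K \<times> topspace Y) (range (\<lambda>i. E i True \<union> E i False)))"
    (is "?L = snd ` ?I")
  proof -
    have "(t, y) \<in> E i True \<union> E i False \<longleftrightarrow> y \<in> D i (\<phi> t i)" for t y i
      by (cases "\<phi> t i") (auto simp: E_def)
    then have I: "?I = {(t, y). t \<in> K \<and> y \<in> topspace Y \<and> (\<forall>i. y \<in> D i (\<phi> t i))}"
      by (simp add: set_eq_iff)
    have "snd ` {(t, y). t \<in> K \<and> y \<in> topspace Y \<and> P t y} = {y \<in> topspace Y. \<exists>t\<in>K. P t y}" for P
      by force
    then show ?thesis
      unfolding I by simp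
  qed
  ultimately show ?thesis
    using closed_map_snd[OF compact_space_Cantor, of Y] unfolding closed_map_def by simp
qed

lemma closed_few_true: "closed {t :: nat \<Rightarrow> bool. card {i. i < m \<and> t i} \<le> k}"
proof -
  have "open {t :: nat \<Rightarrow> bool. \<not> card {i. i < m \<and> t i} \<le> k}"
  proof (rule open_if_cylinders, intro exI allI impI)
    fix t g :: "nat \<Rightarrow> bool"
    assume t: "t \<in> {t. \<not> card {i. i < m \<and> t i} \<le> k}" and "\<forall>i<m. g i = t i"
    then have "{i. i < m \<and> g i} = {i. i < m \<and> t i}" by auto
    then show "g \<in> {t. \<not> card {i. i < m \<and> t i} \<le> k}" using t by simp
  qed
  then show ?thesis by (simp add: closed_def Collect_neg_eq)
qed

text \<open>Take the range of a strictly increasing \<open>s\<close> with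
  \<open>m k \<le> s k\<close>: only the \<open>s j\<close> with \<open>j < k\<close> can lie below
  \<open>m k\<close>.\<close>

lemma sparse_infinite_set:
  fixes m :: "nat \<Rightarrow> nat"
  obtains t :: "nat \<Rightarrow> bool" where "infinite {i. t i}" "\<And>k. card {i. i < m k \<and> t i} \<le> k"
proof -
  define s where "s k = (\<Sum>j\<le>k. m j + 1)" for k
  have mono: "strict_mono s"
    by (rule strict_mono_Suc_iff[THEN iffD2]) (simp add: s_def)
  have ge: "m k \<le> s k" for k
    unfolding s_def using member_le_sum[of k "{..k}" "\<lambda>j. m j + 1"] by simp
  have sub: "{i. i < m k \<and> i \<in> range s} \<subseteq> s ` {..<k}" for k
  proof clarify
    fix j assume "s j < m k"
    then have "s j < s k" using ge[of k] by linarith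
    then have "j < k" using mono strict_mono_less by blast
    then show "s j \<in> s ` {..<k}" by blast
  qed
  have "card {i. i < m k \<and> i \<in> range s} \<le> k" for k
    using card_mono[OF _ sub[of k]] card_image_le[of "{..<k}" s] by simp
  moreover have "infinite {i. i \<in> range s}"
    using mono by (simp add: range_inj_infinite strict_mono_imp_inj_on)
  ultimately show thesis by (rule that[rotated])
qed

lemma few_true_imp_finite:
  fixes t :: "nat \<Rightarrow> bool"
  assumes "\<And>m. card {i. i < m \<and> t i} \<le> k"
  shows "finite {i. t i}"
proof (rule ccontr)
  assume "infinite {i. t i}"
  then obtain T where T: "T \<subseteq> {i. t i}" "finite T" "card T = Suc k"
    using infinite_arbitrarily_large by blast
  then obtain m where "\<forall>i\<in>T. i < m"
    using finite_nat_set_iff_bounded by blast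
  then have "card T \<le> card {i. i < m \<and> t i}"
    using T by (intro card_mono) auto
  then show False using assms[of m] T(3) by linarith
qed

text \<open>Perfectness enters here: the points of \<open>X\<close> mapped off \<open>F s\<close>
  form an F-sigma set, hence a Lindelof one. Countably many open sets with closures off
  \<open>F s\<close> cover its image, and each gives the pair of its complement and its
  closure.\<close>

lemma separating_closed_pairs:
  fixes F :: "nat list \<Rightarrow> 'b set"
  assumes lin: "Lindelof_space X" and perf: "closed_gdelta_space X"
    and reg: "regular_space Y" and e: "continuous_map X Y e" and F: "\<And>s. closedin Y (F s)"
  shows "\<exists>D :: nat \<Rightarrow> bool \<Rightarrow> 'b set.
    (\<forall>i c. closedin Y (D i c)) \<and> (\<forall>i. D i True \<union> D i False = topspace Y) \<and>
    (\<forall>x\<in>topspace X. \<forall>s. e x \<notin> F s \<longrightarrow> (\<exists>i. e x \<notin> D i True \<and> D i False \<inter> F s = {}))"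
proof -
  have "\<exists>V :: nat \<Rightarrow> 'b set. (\<forall>j. openin Y (V j) \<and> Y closure_of V j \<subseteq> topspace Y - F s) \<and>
      e ` {x \<in> topspace X. e x \<notin> F s} \<subseteq> (\<Union>j. V j)" for s
  proof -
    have "closedin X {x \<in> topspace X. e x \<in> F s}"
      using e F by (rule closedin_continuous_map_preimage)
    then have "fsigma_in X (topspace X - {x \<in> topspace X. e x \<in> F s})"
      using perf unfolding closed_gdelta_space_def gdelta_in_fsigma_in by blast
    moreover have "topspace X - {x \<in> topspace X. e x \<in> F s} = {x \<in> topspace X. e x \<notin> F s}"
      by blast
    ultimately have lin_s: "Lindelof_space (subtopology X {x \<in> topspace X. e x \<notin> F s})"
      using Lindelof_fsigma_in_subtopology[OF lin] by simp
    have sub: "e ` {x \<in> topspace X. e x \<notin> F s} \<subseteq> topspace Y - F s"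
      using e by (auto simp: continuous_map_def Pi_iff)
    have op: "openin Y (topspace Y - F s)"
      using F by blast
    obtain V :: "nat \<Rightarrow> 'b set" where "\<And>j. openin Y (V j)"
      "\<And>j. Y closure_of V j \<subseteq> topspace Y - F s" "e ` {x \<in> topspace X. e x \<notin> F s} \<subseteq> (\<Union>j. V j)"
      by (rule Lindelof_closure_cover[OF lin_s _ e reg op sub]) auto
    then show ?thesis by blast
  qed
  then obtain V where V: "\<And>s j. openin Y (V s j)"
    "\<And>s j::nat. Y closure_of V s j \<subseteq> topspace Y - F s"
    "\<And>s. e ` {x \<in> topspace X. e x \<notin> F s} \<subseteq> (\<Union>j. V s j)"
    by metis
  define W where "W i = (case from_nat i of (s, j) \<Rightarrow> V s j)" for i
  have W: "openin Y (W i)" for i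
    using V(1) by (auto simp: W_def split: prod.split)
  define D where "D i c = (if c then topspace Y - W i else Y closure_of W i)" for i c
  show ?thesis
  proof (intro exI[of _ D] conjI allI ballI impI)
    show "closedin Y (D i c)" for i c
      using W by (auto simp: D_def)
    show "D i True \<union> D i False = topspace Y" for i
      using closure_of_subset[OF openin_subset[OF W[of i]]] closure_of_subset_topspace[of Y "W i"]
      by (auto simp: D_def)
    fix x s assume "x \<in> topspace X" "e x \<notin> F s"
    then obtain j where "e x \<in> V s j" using V(3) by blast
    moreover have "W (to_nat (s, j)) = V s j" by (simp add: W_def)
    ultimately have "e x \<notin> D (to_nat (s, j)) True \<and> D (to_nat (s, j)) False \<inter> F s = {}"
      using V(2)[of s j] by (auto simp: D_def)
    then show "\<exists>i. e x \<notin> D i True \<and> D i False \<inter> F s = {}" ..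
  qed
qed

text \<open>The dichotomy is applied to the set \<open>B\<close> of codes \<open>b\<close> whose
  \<open>Z b\<close> meets the remainder: closed pieces of \<open>- B\<close> yield compact pieces
  of the image of \<open>X\<close>, and a reduction to \<open>B\<close> contradicts the Menger
  property.\<close>

lemma Menger_co_Souslin_imp_sigma_compact:
  fixes F :: "nat list \<Rightarrow> 'b set"
  assumes det: coanalytic_determinacy
    and Y: "compact_space Y" "Hausdorff_space Y" and e: "continuous_map X Y e"
    and X: "Menger_space X" "closed_gdelta_space X"
    and F: "\<And>s. closedin Y (F s)" and F_mono: "\<And>s j. F (s @ [j]) \<subseteq> F s"
    and R: "topspace Y - e ` topspace X = (\<Union>\<alpha>. \<Inter>n. F (map \<alpha> [0..<n]))"
  shows "\<exists>L :: nat \<Rightarrow> 'b set. (\<forall>n. compactin Y (L n)) \<and> (\<Union>n. L n) = e ` topspace X"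
proof -
  have reg: "regular_space Y"
    using Y by (rule compact_Hausdorff_imp_regular_space)
  from separating_closed_pairs[where F = F, OF Menger_imp_Lindelof_space[OF X(1)] X(2) reg e F]
  obtain D :: "nat \<Rightarrow> bool \<Rightarrow> 'b set" where D0: "(\<forall>i c. closedin Y (D i c)) \<and> (\<forall>i. D i True \<union> D i False = topspace Y) \<and>
    (\<forall>x\<in>topspace X. \<forall>s. e x \<notin> F s \<longrightarrow> (\<exists>i. e x \<notin> D i True \<and> D i False \<inter> F s = {}))" ..
  then have D: "closedin Y (D i c)" and D_Un: "D i True \<union> D i False = topspace Y" for i c
    by simp_all
  have D_sep: "\<exists>i. e x \<notin> D i True \<and> D i False \<inter> F s = {}"
    if "x \<in> topspace X" "e x \<notin> F s" for x s
    using D0 that by simp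
  define Z where "Z b = {y \<in> topspace Y. \<forall>i. y \<in> D i (b i)}" for b
  \<comment> \<open>Finite approximations to \<open>Z b\<close> meeting all \<open>F\<close> along a
    branch.\<close>
  define \<Phi> where "\<Phi> u s \<longleftrightarrow> (\<exists>y\<in>F s. \<forall>i<length u. y \<in> D i (u ! i))" for u s
  define B where "B = tree_projection \<Phi>"
  have eX: "e ` topspace X \<subseteq> topspace Y"
    using e by (auto simp: continuous_map_def)
  \<comment> \<open>Some pair separates \<open>e x\<close> from a set
    \<open>F (map \<alpha> [0..<n])\<close> containing \<open>y\<close>; either side chosen by
    \<open>b\<close> expels one of the two points.\<close>
  have Z_disj: "e x \<notin> Z b" if x: "x \<in> topspace X" and y: "y \<in> Z b" "y \<notin> e ` topspace X" for x y b
  proof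
    assume ex: "e x \<in> Z b"
    have "y \<in> topspace Y - e ` topspace X" using y by (simp add: Z_def)
    then obtain \<alpha> where \<alpha>: "\<And>n. y \<in> F (map \<alpha> [0..<n])" unfolding R by blast
    have "e x \<notin> topspace Y - e ` topspace X" using x by blast
    then obtain n where "e x \<notin> F (map \<alpha> [0..<n])" unfolding R by blast
    then obtain i where i: "e x \<notin> D i True" "D i False \<inter> F (map \<alpha> [0..<n]) = {}"
      using D_sep[OF x] by blast
    show False
    proof (cases "b i")
      case True
      then show False using i(1) ex by (auto simp: Z_def dest: spec[of _ i])
    next
      case False
      then have "y \<in> D i False" using y(1) by (auto simp: Z_def dest: spec[of _ i])
      then show False using i(2) \<alpha>[of n] by blast
    qed
  qed
  have B: "b \<in> B \<longleftrightarrow> (\<exists>y\<in>Z b. y \<notin> e ` topspace X)" for b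
  proof
    assume "b \<in> B"
    then obtain \<alpha> where \<alpha>: "\<And>n. \<Phi> (map b [0..<n]) (map \<alpha> [0..<n])"
      unfolding B_def tree_projection_def by blast
    \<comment> \<open>Compactness of \<open>Y\<close> turns the passed finite tests into one point
      of \<open>Z b\<close> in the remainder.\<close>
    define C where "C n = \<Inter> (insert (F (map \<alpha> [0..<n])) ((\<lambda>i. D i (b i)) ` {..<n}))" for n
    have "C n \<noteq> {}" for n
      using \<alpha>[of n] unfolding C_def \<Phi>_def by auto
    moreover have "closedin Y (C n)" for n
      unfolding C_def using F D by (intro closedin_Inter) auto
    moreover have "decseq C"
    proof (rule decseq_SucI)
      fix n show "C (Suc n) \<subseteq> C n"
        using F_mono[of "map \<alpha> [0..<n]" "\<alpha> n"] by (auto simp: C_def)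
    qed
    ultimately have "(\<Inter>n. C n) \<noteq> {}"
      using Y(1) by (intro compact_space_imp_nest) auto
    then obtain y where y: "\<And>n. y \<in> C n" by blast
    have "y \<in> topspace Y - e ` topspace X"
      unfolding R using y by (auto simp: C_def)
    moreover have "y \<in> D i (b i)" for i
      using y[of "Suc i"] by (simp add: C_def)
    ultimately show "\<exists>y\<in>Z b. y \<notin> e ` topspace X"
      by (auto simp: Z_def)
  next
    assume "\<exists>y\<in>Z b. y \<notin> e ` topspace X"
    then obtain y where y: "y \<in> Z b" "y \<in> topspace Y - e ` topspace X"
      by (auto simp: Z_def)
    then obtain \<alpha> where "\<And>n. y \<in> F (map \<alpha> [0..<n])" unfolding R by blast
    then have "\<Phi> (map b [0..<n]) (map \<alpha> [0..<n])" for n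
      using y(1) by (auto simp: \<Phi>_def Z_def)
    then show "b \<in> B" unfolding B_def tree_projection_def by blast
  qed
  have Z_B: "b \<notin> B" if "x \<in> topspace X" "e x \<in> Z b" for x b
    using B[of b] Z_disj[of x _ b] that by blast
  show ?thesis
  proof (rule coanalytic_Hurewicz_dichotomy[OF det, of \<Phi>])
    fix K :: "nat \<Rightarrow> (nat \<Rightarrow> bool) set"
    assume K: "\<And>n. closed (K n)" and "(\<Union>n. K n) = - tree_projection \<Phi>"
    then have K_Un: "(\<Union>n. K n) = - B" by (simp add: B_def)
    define L where "L n = {y \<in> topspace Y. \<exists>t\<in>K n. \<forall>i. y \<in> D i (t i)}" for n
    have L: "y \<in> L n \<longleftrightarrow> (\<exists>t\<in>K n. y \<in> Z t)" for y n
      by (auto simp: L_def Z_def)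
    have "closedin Y (L n)" for n
      unfolding L_def using D K by (rule closedin_Cantor_projection) auto
    then have "compactin Y (L n)" for n
      using Y(1) by (rule closedin_compact_space[rotated])
    moreover have "(\<Union>n. L n) = e ` topspace X"
    proof (intro equalityI subsetI)
      fix y assume "y \<in> (\<Union>n. L n)"
      then obtain n t where t: "t \<in> K n" "y \<in> Z t" using L by blast
      then have "t \<notin> B" using K_Un by blast
      then show "y \<in> e ` topspace X" using t(2) B[of t] by blast
    next
      fix y assume "y \<in> e ` topspace X"
      then obtain x where x: "x \<in> topspace X" "y = e x" by blast
      \<comment> \<open>The side \<open>False\<close> is taken whenever it contains
        \<open>y\<close>; as each pair covers \<open>Y\<close>, the chosen side always contains
        \<open>y\<close>.\<close>
      define t where "t i \<longleftrightarrow> y \<notin> D i False" for i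
      have "y \<in> topspace Y" using eX x by blast
      then have "y \<in> D i (t i)" for i
        using D_Un[of i] by (cases "t i") (auto simp: t_def)
      then have y: "y \<in> Z t" using \<open>y \<in> topspace Y\<close> by (simp add: Z_def)
      then have "t \<notin> B" using Z_B x by simp
      then have "t \<in> (\<Union>n. K n)" unfolding K_Un by simp
      then obtain n where "t \<in> K n" ..
      then have "y \<in> L n" using L y by auto
      then show "y \<in> (\<Union>n. L n)" by blast
    qed
    ultimately show ?thesis by (intro exI[of _ L] conjI allI)
  next
    fix \<phi> :: "(nat \<Rightarrow> bool) \<Rightarrow> nat \<Rightarrow> bool"
    assume \<phi>: "\<And>t t' n. \<forall>i<n. t i = t' i \<Longrightarrow> \<phi> t n = \<phi> t' n"
      and "\<And>t. \<phi> t \<in> tree_projection \<Phi> \<longleftrightarrow> finite {i. t i}"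
    then have \<phi>B: "\<phi> t \<in> B \<longleftrightarrow> finite {i. t i}" for t by (simp add: B_def)
    \<comment> \<open>For fixed \<open>k\<close>, these sets decrease in \<open>m\<close> to the
      sequences with at most \<open>k\<close> ones, whose images under \<open>\<phi>\<close> lie in
      \<open>B\<close>.\<close>
    define T where "T k m = {t :: nat \<Rightarrow> bool. card {i. i < m \<and> t i} \<le> k}" for k m
    define U where "U k m = {x \<in> topspace X. \<not> (\<exists>t\<in>T k m. e x \<in> Z (\<phi> t))}" for k m
    have T_mono: "T k n \<subseteq> T k m" if "m \<le> n" for k m n
    proof -
      have "card {i. i < m \<and> t i} \<le> card {i. i < n \<and> t i}" for t :: "nat \<Rightarrow> bool"
        using that by (intro card_mono) auto
      then show ?thesis unfolding T_def by (auto intro: le_trans)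
    qed
    have T_closed: "closed (T k m)" for k m
      unfolding T_def by (rule closed_few_true)
    have U_open: "openin X (U k m)" for k m
    proof -
      let ?C = "{y \<in> topspace Y. \<exists>t\<in>T k m. \<forall>i. y \<in> D i (\<phi> t i)}"
      have "closedin Y ?C"
        by (rule closedin_Cantor_projection[OF D T_closed]) (rule \<phi>, simp)
      then have "closedin X {x \<in> topspace X. e x \<in> ?C}"
        by (rule closedin_continuous_map_preimage[OF e])
      moreover have "U k m = topspace X - {x \<in> topspace X. e x \<in> ?C}"
        using eX by (auto simp: U_def Z_def)
      ultimately show ?thesis by (simp add: openin_diff)
    qed
    \<comment> \<open>A point outside all \<open>U k m\<close> would by compactness lie in
      \<open>Z (\<phi> t)\<close> for some \<open>t\<close> with at most \<open>k\<close> ones; but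
      then \<open>Z (\<phi> t)\<close> also meets the remainder, contrary to
      \<open>Z_B\<close>.\<close>
    have U_cover: "(\<Union>m. U k m) = topspace X" for k
    proof (rule ccontr)
      assume "(\<Union>m. U k m) \<noteq> topspace X"
      moreover have "(\<Union>m. U k m) \<subseteq> topspace X"
        by (auto simp: U_def)
      ultimately obtain x where x: "x \<in> topspace X" and xU: "x \<notin> (\<Union>m. U k m)"
        by blast
      have "\<exists>t\<in>T k m. e x \<in> Z (\<phi> t)" for m
        using x xU by (simp add: U_def)
      then have ne: "T k m \<inter> {t. e x \<in> Z (\<phi> t)} \<noteq> {}" for m by blast
      have "closed {t. e x \<in> Z (\<phi> t)}"
        unfolding closed_def
      proof (rule open_if_cylinders)
        fix t assume "t \<in> - {t. e x \<in> Z (\<phi> t)}"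
        then obtain i where "e x \<notin> D i (\<phi> t i)" using eX x by (auto simp: Z_def)
        then have "e x \<notin> D i (\<phi> g i)" if "\<forall>j<i. g j = t j" for g
          using \<phi>[OF that] by simp
        then have "g \<in> - {t. e x \<in> Z (\<phi> t)}" if "\<forall>j<i. g j = t j" for g
          using that unfolding Z_def by blast
        then show "\<exists>n. \<forall>g. (\<forall>j<n. g j = t j) \<longrightarrow> g \<in> - {t. e x \<in> Z (\<phi> t)}" by blast
      qed
      then have "closedin euclidean (T k m \<inter> {t. e x \<in> Z (\<phi> t)})" for m
        using T_closed by (simp add: closed_Int)
      moreover have "decseq (\<lambda>m. T k m \<inter> {t. e x \<in> Z (\<phi> t)})"
        using T_mono unfolding decseq_def by blast
      ultimately have "(\<Inter>m. T k m \<inter> {t. e x \<in> Z (\<phi> t)}) \<noteq> {}"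
        using compact_space_Cantor ne by (intro compact_space_imp_nest) auto
      then obtain t where t: "\<And>m. t \<in> T k m" "e x \<in> Z (\<phi> t)" by auto
      have "finite {i. t i}"
        by (rule few_true_imp_finite[of t k]) (use t(1) in \<open>simp add: T_def\<close>)
      then show False using Z_B[OF x t(2)] \<phi>B by simp
    qed
    obtain m where m: "(\<Union>k. U k (m k)) = topspace X"
    proof (rule Menger_spaceD_increasing[OF X(1) U_open])
      show "U k i \<subseteq> U k j" if "i \<le> j" for k i j
        using T_mono[OF that] unfolding U_def by blast
    qed (use U_cover in auto)
    \<comment> \<open>This \<open>t\<close> lies in every \<open>T k (m k)\<close>, although
      \<open>\<phi> t\<close> is outside \<open>B\<close>.\<close>
    obtain t where t: "infinite {i. t i}" "\<And>k. card {i. i < m k \<and> t i} \<le> k"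
      using sparse_infinite_set[of m] by blast
    define C where "C n = \<Inter> (insert (topspace Y) ((\<lambda>i. D i (\<phi> t i)) ` {..<n}))" for n
    have "C n \<noteq> {}" for n
    proof -
      \<comment> \<open>The truncation has finitely many ones, so \<open>Z (\<phi> t')\<close> is
        nonempty; \<open>\<phi> t'\<close> and \<open>\<phi> t\<close> agree below
        \<open>n\<close>.\<close>
      define t' where "t' i \<longleftrightarrow> i < n \<and> t i" for i
      have "finite {i. t' i}" by (simp add: t'_def)
      then obtain y where y: "y \<in> Z (\<phi> t')" using \<phi>B[of t'] B[of "\<phi> t'"] by blast
      have "\<phi> t' i = \<phi> t i" if "i < n" for i
        using that by (intro \<phi>) (auto simp: t'_def)
      then have "y \<in> D i (\<phi> t i)" if "i < n" for i
        using y that by (auto simp: Z_def dest: spec[of _ i])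
      then have "y \<in> C n"
        using y by (auto simp: C_def Z_def)
      then show ?thesis by blast
    qed
    moreover have "closedin Y (C n)" for n
      unfolding C_def using D by (intro closedin_Inter) auto
    moreover have "decseq C"
      by (rule decseq_SucI) (auto simp: C_def)
    ultimately have "(\<Inter>n. C n) \<noteq> {}"
      using Y(1) by (intro compact_space_imp_nest) auto
    then obtain y where y: "\<And>n. y \<in> C n" by blast
    have "y \<in> topspace Y" "y \<in> D i (\<phi> t i)" for i
      using y[of "Suc i"] by (auto simp: C_def)
    then have yZ: "y \<in> Z (\<phi> t)" by (simp add: Z_def)
    \<comment> \<open>As \<open>\<phi> t\<close> is outside \<open>B\<close>, the point
      \<open>y\<close> comes from \<open>X\<close>; yet no \<open>U k (m k)\<close> contains its
      preimage \<open>x\<close>.\<close>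
    then obtain x where x: "x \<in> topspace X" "y = e x"
      using B[of "\<phi> t"] \<phi>B[of t] t(1) by blast
    then obtain k where "x \<in> U k (m k)" using m by blast
    moreover have "t \<in> T k (m k)" using t(2) by (simp add: T_def)
    ultimately show ?thesis using yZ x unfolding U_def by blast
  qed
qed

theorem theorem7p7:
  fixes X :: "'a topology"
  assumes "coanalytic_determinacy"
    and "tychonoff_space X"
    and "closed_gdelta_space X"
    and "co_K_analytic_space TYPE('z) X"
    and "Menger_space X"
  shows "sigma_compact_space X"
proof -
  define Y where "Y = stone_cech X"
  define e where "e = stone_cech_map X"
  have Y: "compact_space Y" "Hausdorff_space Y"
    unfolding Y_def by (rule compact_stone_cech Hausdorff_stone_cech)+
  have hom: "homeomorphic_map X (subtopology Y (e ` topspace X)) e"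
    using embedding_map_stone_cech_map[OF assms(2)] by (simp add: embedding_map_def Y_def e_def)
  have e: "continuous_map X Y e"
    using homeomorphic_imp_continuous_map[OF hom] by (simp add: continuous_map_in_subtopology)
  have K: "K_analytic_space TYPE('z) (subtopology Y (topspace Y - e ` topspace X))"
    using assms(4) by (simp add: co_K_analytic_space_def stone_cech_remainder_def Y_def e_def)
  from K_analytic_Souslin_scheme[OF Y(2) Diff_subset K]
  obtain F :: "nat list \<Rightarrow> _" where F: "(\<forall>s. closedin Y (F s)) \<and> (\<forall>s j. F (s @ [j]) \<subseteq> F s) \<and>
      topspace Y - e ` topspace X = (\<Union>\<alpha>. \<Inter>n. F (map \<alpha> [0..<n]))" ..
  have "\<exists>L. (\<forall>n::nat. compactin Y (L n)) \<and> (\<Union>n. L n) = e ` topspace X"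
    by (rule Menger_co_Souslin_imp_sigma_compact[where F = F, OF assms(1) Y e assms(5,3)])
       (use F in auto)
  then obtain L where L: "\<forall>n::nat. compactin Y (L n)" "(\<Union>n. L n) = e ` topspace X"
    by (elim exE conjE)
  \<comment> \<open>Each \<open>L n\<close> lies in the image of \<open>X\<close>, so the
    homeomorphism onto that image pulls back its compactness.\<close>
  define K where "K n = {x \<in> topspace X. e x \<in> L n}" for n
  have L_sub: "L n \<subseteq> e ` topspace X" for n
    using L(2) by blast
  then have eK: "e ` K n = L n" for n
    by (auto simp: K_def)
  have "compactin X (K n)" for n
  proof -
    have "compactin (subtopology Y (e ` topspace X)) (e ` K n)"
      using L(1) L_sub by (simp add: compactin_subtopology eK)
    then show ?thesis
      using homeomorphic_map_compactness[OF hom, of "K n"] by (auto simp: K_def)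
  qed
  moreover have "(\<Union>n. K n) = topspace X"
  proof -
    have "\<exists>n. e x \<in> L n" if "x \<in> topspace X" for x
      using imageI[OF that, of e] unfolding L(2)[symmetric] by simp
    then show ?thesis by (auto simp: K_def)
  qed
  ultimately show ?thesis
    unfolding sigma_compact_space_def by blast
qed

end
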